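(* The class $\#\mathrm{P}^{(\mathrm{pt})}_{\mathbb{Q}}$ is not $\#\mathrm{P}$-equivalent and is not a subset of $\mathrm{FP}^{\#\mathrm{P}}$.
   Context: $\#\mathrm{P}^{(\mathrm{pt})}_{\mathbb{Q}}$ is the class of functions $f:\{0,1\}^\star\to\mathbb{Q}$ of the form $f(x)=\sum_{u\in\{0,1\}^{p(|x|)}} w(x,u)$, where $p:\mathbb{N}\to\mathbb{N}$ is a polynomial and $w:\{0,1\}^\star\times\{0,1\}^\star\to\mathbb{Q}$ is computable in time polynomial in the size of its input (rationals are encoded as fractions of integers written in binary). $\#\mathrm{P}$ is the usual class of counting functions $f(x)=\sum_{u\in\{0,1\}^{p(|x|)}}T(x,u)$ with $p$ a polynomial and $T$ a polynomial-time $\{0,1\}$-valued predicate. $\mathrm{FP}^{\#\mathrm{P}}$ is the class of functions computable in deterministic polynomial time with access to a $\#\mathrm{P}$ oracle (rational outputs encoded as fractions of binary integers). A function $f:\{0,1\}^\star\to\mathbb{R}$ affinely reduces to $g:\{0,1\}^\star\to\mathbb{R}$ if there are polynomial-time computable functions $h_1,h_2,h_3$ ($h_1,h_3$ rational-valued, $h_2$ string-valued) with $f(x)=h_1(x)\cdot g(h_2(x))+h_3(x)$ for all $x\in\{0,1\}^\star$. A class $C$ of functions is $\#\mathrm{P}$-equivalent if every problem in $C$ affinely reduces to some problem in $\#\mathrm{P}$ and every problem in $\#\mathrm{P}$ affinely reduces to some problem in $C$. *)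

theory Defs
  imports Complex_Main "HOL-Computational_Algebra.Polynomial"
begin

text \<open>Deterministic multi-tape Turing machines with two-way infinite tapes.\<close>

datatype symbol = Blank | is_Bit: Bit (the_bit: bool) | Minus | Slash | Sep | Aux nat

definition io_symbols :: "symbol set" where
  "io_symbols = {Blank, Bit False, Bit True, Minus, Slash, Sep}"

datatype move = MLeft | MStay | MRight

fun offset :: "move \<Rightarrow> int" where
  "offset MLeft = -1"
| "offset MStay = 0"
| "offset MRight = 1"

text \<open>A tape is its cell contents together with the position of the head.\<close>

type_synonym tape = "(int \<Rightarrow> symbol) \<times> int"

definition tape_of :: "symbol list \<Rightarrow> tape" where
  "tape_of s = ((\<lambda>i. if 0 \<le> i \<and> i < int (length s) then s ! nat i else Blank), 0)"

definition read :: "tape \<Rightarrow> symbol" where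
  "read tp = fst tp (snd tp)"

definition act :: "symbol \<times> move \<Rightarrow> tape \<Rightarrow> tape" where
  "act a tp = ((fst tp)(snd tp := fst a), snd tp + offset (snd a))"

text \<open>
  The string on a tape occupies the cells from 0 up to the first blank. The minimum below exists
  for every tape with finitely many non-blank cells, hence for every tape in a computation.
\<close>

definition contents :: "tape \<Rightarrow> symbol list" where
  "contents tp = map (\<lambda>i. fst tp (int i)) [0..<(LEAST n. fst tp (int n) = Blank)]"

type_synonym config = "nat \<times> tape list"

text \<open>
  Tape 0 is the input tape and tape 1 the output tape. The transition function maps a state and
  the scanned symbols to the next state and, for each tape, a symbol to write and a head move.
\<close>

record machine =
  tape_count :: nat
  states :: "nat set"
  alphabet :: "symbol set"
  start :: nat
  halt :: nat
  trans :: "nat \<Rightarrow> symbol list \<Rightarrow> nat \<times> (symbol \<times> move) list"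

definition wf_machine :: "'m machine_scheme \<Rightarrow> bool" where
  "wf_machine M \<longleftrightarrow>
     2 \<le> tape_count M \<and>
     finite (states M) \<and> start M \<in> states M \<and> halt M \<in> states M \<and>
     finite (alphabet M) \<and> io_symbols \<subseteq> alphabet M \<and>
     (\<forall>q \<in> states M - {halt M}. \<forall>s. length s = tape_count M \<and> set s \<subseteq> alphabet M \<longrightarrow>
        (case trans M q s of (q', as) \<Rightarrow>
           q' \<in> states M \<and> length as = tape_count M \<and> fst ` set as \<subseteq> alphabet M))"

definition initial :: "'m machine_scheme \<Rightarrow> symbol list \<Rightarrow> config" where
  "initial M s = (start M, (replicate (tape_count M) (tape_of []))[0 := tape_of s])"

text \<open>A halted machine stays put, so running for exactly \<open>t\<close> steps and ending in the halting
  state means halting within \<open>t\<close> steps.\<close>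

definition step :: "'m machine_scheme \<Rightarrow> config \<Rightarrow> config" where
  "step M = (\<lambda>(q, ts).
     if q = halt M then (q, ts)
     else case trans M q (map read ts) of (q', as) \<Rightarrow> (q', map2 act as ts))"

text \<open>
  Oracle machines additionally have a query tape 2 and an answer tape 3. In the query
  state, one step applies the oracle to the longest string of bits on tape 2 starting at cell 0,
  erases tape 2, and puts the answer in binary on tape 3. The query tape is distinct from the
  answer tape since otherwise feeding answers back as queries could produce strings of
  superpolynomial length in polynomially many steps.
\<close>

record oracle_machine = machine +
  query_state :: nat
  answer_state :: nat

definition wf_oracle_machine :: "oracle_machine \<Rightarrow> bool" where
  "wf_oracle_machine M \<longleftrightarrow>
     wf_machine M \<and> 4 \<le> tape_count M \<and>
     query_state M \<in> states M \<and> answer_state M \<in> states M \<and> query_state M \<noteq> halt M"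

text \<open>Binary notation: most significant bit first, no superfluous leading zeros.\<close>

fun binary :: "nat \<Rightarrow> bool list" where
  "binary n = (if n < 2 then [n = 1] else binary (n div 2) @ [odd n])"

declare binary.simps [simp del]

definition enc_nat :: "nat \<Rightarrow> symbol list" where
  "enc_nat n = map Bit (binary n)"

definition enc_int :: "int \<Rightarrow> symbol list" where
  "enc_int a = (if a < 0 then [Minus] else []) @ enc_nat (nat \<bar>a\<bar>)"

definition enc_string :: "bool list \<Rightarrow> symbol list" where
  "enc_string x = map Bit x"

definition enc_pair :: "bool list \<times> bool list \<Rightarrow> symbol list" where
  "enc_pair = (\<lambda>(x, u). enc_string x @ [Sep] @ enc_string u)"

definition oracle_step :: "(bool list \<Rightarrow> nat) \<Rightarrow> oracle_machine \<Rightarrow> config \<Rightarrow> config" where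
  "oracle_step g M = (\<lambda>(q, ts).
     if q = query_state M
     then (answer_state M,
           ts[2 := tape_of [],
              3 := tape_of (enc_nat (g (map the_bit (takeWhile is_Bit (contents (ts ! 2))))))])
     else step M (q, ts))"

text \<open>Fractions need not be in lowest terms, so a rational has many encodings.\<close>

definition encodes_rat :: "rat \<Rightarrow> symbol list \<Rightarrow> bool" where
  "encodes_rat r s \<longleftrightarrow>
     (\<exists>a b. 0 < b \<and> r = of_int a / of_int b \<and> s = enc_int a @ [Slash] @ enc_int b)"

definition encodes_string :: "bool list \<Rightarrow> symbol list \<Rightarrow> bool" where
  "encodes_string y s \<longleftrightarrow> s = enc_string y"

definition encodes_bool :: "bool \<Rightarrow> symbol list \<Rightarrow> bool" where
  "encodes_bool b s \<longleftrightarrow> s = [Bit b]"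

definition polynomial_fun :: "(nat \<Rightarrow> nat) \<Rightarrow> bool" where
  "polynomial_fun p \<longleftrightarrow> (\<exists>P :: real poly. \<forall>n. real (p n) = poly P (real n))"

definition polytime ::
    "('a \<Rightarrow> symbol list) \<Rightarrow> ('b \<Rightarrow> symbol list \<Rightarrow> bool) \<Rightarrow> ('a \<Rightarrow> 'b) \<Rightarrow> bool" where
  "polytime enc encodes f \<longleftrightarrow>
     (\<exists>(M :: machine) p. wf_machine M \<and> polynomial_fun p \<and>
        (\<forall>a. case (step M ^^ p (length (enc a))) (initial M (enc a)) of (q, ts) \<Rightarrow>
               q = halt M \<and> encodes (f a) (contents (ts ! 1))))"

definition oracle_polytime ::
    "(bool list \<Rightarrow> nat) \<Rightarrow>
     ('a \<Rightarrow> symbol list) \<Rightarrow> ('b \<Rightarrow> symbol list \<Rightarrow> bool) \<Rightarrow> ('a \<Rightarrow> 'b) \<Rightarrow> bool" where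
  "oracle_polytime g enc encodes f \<longleftrightarrow>
     (\<exists>M p. wf_oracle_machine M \<and> polynomial_fun p \<and>
        (\<forall>a. case (oracle_step g M ^^ p (length (enc a))) (initial M (enc a)) of (q, ts) \<Rightarrow>
               q = halt M \<and> encodes (f a) (contents (ts ! 1))))"

definition sharpP :: "(bool list \<Rightarrow> nat) set" where
  "sharpP = {f. \<exists>p T. polynomial_fun p \<and> polytime enc_pair encodes_bool T \<and>
     (\<forall>x. f x = (\<Sum>u \<in> {u. length u = p (length x)}. of_bool (T (x, u))))}"

definition sharpP_Q_pt :: "(bool list \<Rightarrow> rat) set" where
  "sharpP_Q_pt = {f. \<exists>p w. polynomial_fun p \<and> polytime enc_pair encodes_rat w \<and>
     (\<forall>x. f x = (\<Sum>u \<in> {u. length u = p (length x)}. w (x, u)))}"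

definition FP_sharpP :: "(bool list \<Rightarrow> rat) set" where
  "FP_sharpP = {f. \<exists>g \<in> sharpP. oracle_polytime g enc_string encodes_rat f}"

definition affinely_reduces :: "(bool list \<Rightarrow> real) \<Rightarrow> (bool list \<Rightarrow> real) \<Rightarrow> bool" where
  "affinely_reduces f g \<longleftrightarrow>
     (\<exists>h1 h2 h3.
        polytime enc_string encodes_rat h1 \<and>
        polytime enc_string encodes_string h2 \<and>
        polytime enc_string encodes_rat h3 \<and>
        (\<forall>x. f x = of_rat (h1 x) * g (h2 x) + of_rat (h3 x)))"

definition sharpP_equivalent :: "(bool list \<Rightarrow> real) set \<Rightarrow> bool" where
  "sharpP_equivalent C \<longleftrightarrow>
     (\<forall>f \<in> C. \<exists>g \<in> sharpP. affinely_reduces f (\<lambda>x. of_nat (g x))) \<and>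
     (\<forall>g \<in> sharpP. \<exists>f \<in> C. affinely_reduces (\<lambda>x. of_nat (g x)) f)"

end

theory Submission
  imports Defs
begin

text \<open>
  Take \<open>w (x, u) = 1 / k\<close> where \<open>1u\<close> is the binary notation of \<open>k\<close>, so that summation over the
  strings \<open>u\<close> of length \<open>n = |x|\<close> gives \<open>f x\<close>, the sum of \<open>1 / k\<close> for \<open>2^n \<le> k < 2^(n+1)\<close>. A prime in
  this range divides exactly one of these \<open>k\<close> and hence the denominator of the sum in lowest terms.
  An output of a polynomial-time machine, with or without oracle, has polynomially many symbols;
  so if \<open>f\<close> were in \<open>FP^#P\<close>, or affinely reducible to an integer-valued function, then its
  denominator would have polynomially many bits, and there would be only polynomially many primes
  between \<open>2^n\<close> and \<open>2^(n+1)\<close> for every \<open>n\<close>. Summation over \<open>n\<close> contradicts Chebyshev's lower bound,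
  which follows from \<open>4^N \<le> (2N+1) (2N choose N) \<le> lcm {1..2N+1} \<le> (2N+1)^\<pi>(2N+1)\<close>.
\<close>

section \<open>Polynomial growth\<close>

lemma polynomial_fun_add:
  assumes "polynomial_fun p" "polynomial_fun q"
  shows "polynomial_fun (\<lambda>n. p n + q n)"
proof -
  obtain P Q :: "real poly" where "\<And>n. real (p n) = poly P (real n)" "\<And>n. real (q n) = poly Q (real n)"
    using assms unfolding polynomial_fun_def by blast
  then have "\<forall>n. real (p n + q n) = poly (P + Q) (real n)" by simp
  then show ?thesis unfolding polynomial_fun_def by blast
qed

text \<open>Horner's scheme: each coefficient raises the exponent by one and adds its absolute value
  to the constant. Powers of \<open>1 + x\<close>, unlike those of \<open>x\<close>, are at least 1
  on all of the half-line and so absorb constant terms.\<close>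

lemma abs_poly_bound:
  fixes P :: "real poly"
  shows "\<exists>C d. \<forall>x\<ge>0. \<bar>poly P x\<bar> \<le> C * (1 + x) ^ d"
proof (induction P)
  case 0
  show ?case by (intro exI[of _ 0]) simp
next
  case (pCons a P)
  then obtain C d where b: "\<And>x. x \<ge> 0 \<Longrightarrow> \<bar>poly P x\<bar> \<le> C * (1 + x) ^ d" by blast
  have "\<bar>poly (pCons a P) x\<bar> \<le> (\<bar>a\<bar> + C) * (1 + x) ^ Suc d" if x: "x \<ge> 0" for x
  proof -
    have C: "0 \<le> C * (1 + x) ^ d" using b[OF x] by linarith
    have "\<bar>poly (pCons a P) x\<bar> \<le> \<bar>a\<bar> + x * \<bar>poly P x\<bar>"
      using x abs_triangle_ineq[of a "x * poly P x"] by (simp add: abs_mult)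
    also have "\<dots> \<le> \<bar>a\<bar> * (1 + x) ^ Suc d + (1 + x) * (C * (1 + x) ^ d)"
    proof (intro add_mono mult_mono)
      have "1 \<le> (1 + x) ^ Suc d" using x by (intro one_le_power) auto
      then show "\<bar>a\<bar> \<le> \<bar>a\<bar> * (1 + x) ^ Suc d"
        using mult_left_mono[of 1 "(1 + x) ^ Suc d" "\<bar>a\<bar>"] by simp
    qed (use x b C in auto)
    finally show ?thesis by (simp add: algebra_simps)
  qed
  then show ?case by blast
qed

text \<open>Substitute \<open>ln 2 * real n\<close> for the variable in the limit of
  \<open>x ^ k / exp x\<close>.\<close>

lemma power_over_two_power_tendsto_0: "(\<lambda>n. real n ^ k / 2 ^ n) \<longlonglongrightarrow> 0"
proof -
  have l: "ln 2 > (0::real)" by simp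
  have "filterlim (\<lambda>n. ln 2 * real n) at_top sequentially"
    using l by (intro filterlim_tendsto_pos_mult_at_top[OF tendsto_const])
      (auto intro: filterlim_real_sequentially)
  then have "(\<lambda>n. (ln 2 * real n) ^ k / exp (ln 2 * real n)) \<longlonglongrightarrow> 0"
    by (rule filterlim_compose[OF tendsto_power_div_exp_0])
  then have "(\<lambda>n. 1 / ln 2 ^ k * ((ln 2 * real n) ^ k / exp (ln 2 * real n))) \<longlonglongrightarrow> 1 / ln 2 ^ k * 0"
    by (rule tendsto_mult[OF tendsto_const])
  moreover have "exp (ln 2 * real n) = 2 ^ n" for n
    using exp_of_nat2_mult[of "ln (2::real)" n] by simp
  ultimately show ?thesis using l by (simp add: power_mult_distrib)
qed

section \<open>Primes in dyadic intervals\<close>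

text \<open>The rule of the Leibniz harmonic triangle, whose entries are
  \<open>1 / ((m + 1) * (m choose k))\<close>: an entry is the one diagonally above it minus its
  left neighbour. The absorption identities express both binomials of row \<open>Suc m\<close>
  through \<open>m choose k\<close>.\<close>

lemma leibniz_triangle:
  assumes "k \<le> m"
  shows "1 / (real (m + 2) * real (Suc m choose Suc k)) =
    1 / (real (m + 1) * real (m choose k)) - 1 / (real (m + 2) * real (Suc m choose k))"
proof -
  define c where "c = real (m choose k)"
  have c: "c > 0" using assms by (simp add: c_def)
  have "Suc k * (Suc m choose Suc k) = Suc m * (m choose k)" by (rule Suc_times_binomial)
  then have "real (Suc k) * real (Suc m choose Suc k) = real (Suc m) * c"
    unfolding c_def by (metis of_nat_mult)
  then have 1: "real (Suc m choose Suc k) = real (Suc m) * c / real (Suc k)"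
    by (simp add: field_simps)
  have "(Suc m - k) * (Suc m choose k) = Suc m * (m choose k)"
    using binomial_absorb_comp[of "Suc m" k] by simp
  then have "real (Suc m - k) * real (Suc m choose k) = real (Suc m) * c"
    unfolding c_def by (metis of_nat_mult)
  then have 2: "real (Suc m choose k) = real (Suc m) * c / (real (Suc m) - real k)"
    using assms by (simp add: field_simps of_nat_diff)
  have "real (Suc m) - real k > 0" using assms by simp
  then show ?thesis using c unfolding 1 2 c_def[symmetric]
    by (simp add: divide_simps)
qed

text \<open>
  Induction along the columns of the Leibniz harmonic triangle: \<open>L\<close> times each entry is an integer
  since this holds in column 0.
\<close>

lemma times_binomial_dvd:
  assumes "k \<le> n" "\<And>j. j \<in> {1..Suc n} \<Longrightarrow> j dvd L"
  shows "Suc n * (n choose k) dvd (L :: nat)"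
proof -
  have "real L / (real (Suc n) * real (n choose k)) \<in> \<int>"
    using assms
  proof (induction k arbitrary: n)
    case 0
    then have "Suc n dvd L" by auto
    then obtain c where c: "L = Suc n * c" by blast
    have "real L / (real (Suc n) * real (n choose 0)) = real c" unfolding c of_nat_mult by simp
    then show ?case by simp
  next
    case (Suc k)
    then obtain m where m: "n = Suc m" "k \<le> m" by (cases n) auto
    have "real L / (real (Suc m) * real (m choose k)) \<in> \<int>"
      using Suc.prems m by (intro Suc.IH) auto
    moreover have "real L / (real (Suc n) * real (n choose k)) \<in> \<int>"
      using Suc.prems by (intro Suc.IH) auto
    moreover have "real L / (real (Suc n) * real (n choose Suc k)) =
        real L * (1 / (real (m + 2) * real (Suc m choose Suc k)))"
      by (simp add: m(1))
    then have "real L / (real (Suc n) * real (n choose Suc k)) =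
        real L / (real (Suc m) * real (m choose k)) - real L / (real (Suc n) * real (n choose k))"
      unfolding leibniz_triangle[OF m(2)] by (simp add: m(1) right_diff_distrib)
    ultimately show ?case by (metis Ints_diff)
  qed
  then obtain z where "real L / (real (Suc n) * real (n choose k)) = of_int z" by (elim Ints_cases)
  moreover have "real (Suc n) * real (n choose k) \<noteq> 0" using assms(1) by simp
  ultimately have "real L = of_int z * (real (Suc n) * real (n choose k))" by (simp add: divide_eq_eq)
  then have "int L = z * int (Suc n * (n choose k))"
    by (metis of_int_eq_iff of_int_mult of_int_of_nat_eq of_nat_mult)
  then show ?thesis by (metis dvd_triv_right int_dvd_int_iff)
qed

text \<open>The exponent of a prime in an lcm is the maximum of its exponents in the members, and
  some member attains it. A positive exponent rules out the empty set, whose lcm is 1.\<close>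

lemma prime_power_dvd_Lcm:
  assumes "finite A" "0 \<notin> A" "prime p" "p ^ e dvd Lcm A" "e > 0"
  shows "\<exists>k\<in>A. p ^ e dvd (k :: nat)"
  using assms
proof (induction A rule: finite_induct)
  case (insert x A)
  have nz: "Lcm A \<noteq> 0" using insert by (simp add: Lcm_0_iff)
  have "e \<le> multiplicity p (lcm x (Lcm A))"
    using insert nz by (intro multiplicity_geI) (auto simp: prime_gt_1_nat lcm_eq_0_iff)
  also have "\<dots> = max (multiplicity p x) (multiplicity p (Lcm A))"
    using insert.prems nz by (subst multiplicity_lcm) auto
  finally consider "e \<le> multiplicity p x" | "e \<le> multiplicity p (Lcm A)" by linarith
  then show ?case
    using insert by cases (auto dest: multiplicity_dvd')
qed auto

text \<open>Each full prime power in the lcm already divides a member of \<open>{1..M}\<close>, so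
  it is at most \<open>M\<close>; there is one such factor for each prime divisor, and these are
  primes up to \<open>M\<close>.\<close>

lemma Lcm_le_power_prime_count:
  "Lcm {1..M} \<le> M ^ card {p::nat. prime p \<and> p \<le> M}"
proof -
  let ?L = "Lcm {1..M}" and ?P = "{p::nat. prime p \<and> p \<le> M}"
  have L: "?L \<noteq> 0" by (simp add: Lcm_0_iff)
  have pow: "p ^ multiplicity p ?L \<le> M" if p: "p \<in> prime_factors ?L" for p
  proof -
    have "multiplicity p ?L > 0" "prime p"
      using p by (auto simp: prime_factors_multiplicity)
    then obtain k where "k \<in> {1..M}" "p ^ multiplicity p ?L dvd k"
      using prime_power_dvd_Lcm[of "{1..M}" p "multiplicity p ?L"] multiplicity_dvd[of p ?L] by auto
    then show ?thesis using dvd_imp_le[of "p ^ multiplicity p ?L" k] by auto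
  qed
  have sub: "prime_factors ?L \<subseteq> ?P"
  proof
    fix p assume p: "p \<in> prime_factors ?L"
    then have "p \<le> p ^ multiplicity p ?L"
      by (intro self_le_power) (auto simp: prime_factors_multiplicity Suc_le_eq prime_gt_0_nat)
    then show "p \<in> ?P" using p pow[OF p] by auto
  qed
  have fin: "finite ?P" by simp
  have "?L = (\<Prod>p\<in>prime_factors ?L. p ^ multiplicity p ?L)"
    using L by (intro prime_factorization_nat) blast
  also have "\<dots> \<le> (\<Prod>p\<in>prime_factors ?L. M)" using pow by (intro prod_mono) auto
  also have "\<dots> = M ^ card (prime_factors ?L)" by simp
  also have "\<dots> \<le> M ^ card ?P"
  proof (cases "M = 0")
    case False
    then show ?thesis using card_mono[OF fin sub] by (intro power_increasing) auto
  next
    \<comment> \<open>Powers of 0 do not increase with the exponent, but here both exponents are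
      0.\<close>
    case True
    then have "?P = {}" by auto
    with sub have "prime_factors ?L = ?P" by auto
    then show ?thesis by (simp only: order_refl)
  qed
  finally show ?thesis .
qed

section \<open>Primes grouped by binary length\<close>

definition dyadic_primes :: "nat \<Rightarrow> nat set" where
  "dyadic_primes i = {p. prime p \<and> 2 ^ i \<le> p \<and> p < 2 ^ Suc i}"

lemma finite_dyadic_primes [simp]: "finite (dyadic_primes i)"
  by (rule finite_subset[of _ "{..<2 ^ Suc i}"]) (auto simp: dyadic_primes_def)

lemma primes_below_power_of_two:
  "{p::nat. prime p \<and> p < 2 ^ n} \<subseteq> (\<Union>i<n. dyadic_primes i)"
proof
  fix p :: nat assume "p \<in> {p. prime p \<and> p < 2 ^ n}"
  then have p: "prime p" "p < 2 ^ n" by auto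
  then obtain i where i: "2 ^ i \<le> p" "p < 2 ^ (i + 1)"
    using ex_power_ivl1[of 2 p] prime_ge_1_nat by auto
  have "(2::nat) ^ i < 2 ^ n" using i p by linarith
  then have "i < n" by simp
  then show "p \<in> (\<Union>i<n. dyadic_primes i)" using i p by (auto simp: dyadic_primes_def)
qed

text \<open>Chebyshev's lower bound for the primes below \<open>2 ^ n\<close>, in a form without
  division or logarithms.\<close>

lemma chebyshev_dyadic:
  assumes "n \<ge> 2"
  shows "2 ^ n \<le> 2 * n * (\<Sum>i<n. card (dyadic_primes i))"
proof -
  obtain m where n: "n = m + 2" using assms by (metis add.commute le_Suc_ex)
  \<comment> \<open>This choice gives \<open>2 * N + 1 < 4 * N = 2 ^ n\<close>, which bounds both
    the primes counted and the base of the power in the lcm estimate.\<close>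
  define N :: nat where "N = 2 ^ m"
  let ?P = "{p::nat. prime p \<and> p \<le> 2 * N + 1}"
  have N: "N > 0" by (simp add: N_def)
  have "2 ^ n = 4 * N" by (simp add: n N_def)
  then have N': "2 * N + 1 < 2 ^ n" using N by linarith
  have "card ?P \<le> card {p::nat. prime p \<and> p < 2 ^ n}"
    using N' by (intro card_mono) auto
  also have "\<dots> \<le> card (\<Union>i<n. dyadic_primes i)"
    by (intro card_mono primes_below_power_of_two) auto
  also have "\<dots> \<le> (\<Sum>i<n. card (dyadic_primes i))" by (rule card_UN_le) auto
  finally have count: "card ?P \<le> (\<Sum>i<n. card (dyadic_primes i))" .
  have "real (4 ^ N) \<le> real (2 * N * (2 * N choose N))"
    using central_binomial_lower_bound[of N] N by (simp add: field_simps)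
  then have "4 ^ N \<le> 2 * N * (2 * N choose N)" using of_nat_le_iff by blast
  also have "\<dots> \<le> Suc (2 * N) * (2 * N choose N)" by simp
  also have "\<dots> \<le> Lcm {1..2 * N + 1}"
  proof (rule dvd_imp_le)
    show "Suc (2 * N) * (2 * N choose N) dvd Lcm {1..2 * N + 1}"
      by (rule times_binomial_dvd) (auto intro: dvd_Lcm)
    have "Lcm {1..2 * N + 1} \<noteq> 0" by (simp add: Lcm_0_iff)
    then show "0 < Lcm {1..2 * N + 1}" by blast
  qed
  also have "\<dots> \<le> (2 * N + 1) ^ card ?P" by (rule Lcm_le_power_prime_count)
  also have "\<dots> \<le> (2 ^ n) ^ card ?P"
    using N' by (intro power_mono) auto
  \<comment> \<open>Comparison of exponents of 2 bounds \<open>2 * N\<close>, which is half of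
    \<open>2 ^ n\<close>; hence the factor 2 in the claim.\<close>
  finally have "(2::nat) ^ (2 * N) \<le> 2 ^ (n * card ?P)" by (simp add: power_mult)
  then have "2 * N \<le> n * card ?P" by simp
  also have "\<dots> \<le> n * (\<Sum>i<n. card (dyadic_primes i))" using count by simp
  finally show ?thesis by (simp add: n N_def)
qed

text \<open>Chebyshev's bound concerns all blocks below \<open>2 ^ n\<close> together. If every
  block obeyed a polynomial bound, so would their sum, against its exponential growth; thus at least
  one block is rich, which suffices for the separation.\<close>

lemma dyadic_primes_superpolynomial:
  assumes "polynomial_fun q"
  shows "\<exists>i. q i < card (dyadic_primes i)"
proof (rule ccontr)
  assume "\<not> ?thesis"
  then have le: "card (dyadic_primes i) \<le> q i" for i by (meson not_less)
  obtain Q :: "real poly" where Q: "\<And>n. real (q n) = poly Q (real n)"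
    using assms unfolding polynomial_fun_def by blast
  obtain C d where "\<And>x. x \<ge> 0 \<Longrightarrow> \<bar>poly Q x\<bar> \<le> C * (1 + x) ^ d" using abs_poly_bound by blast
  then have q: "real (q i) \<le> C * (1 + real i) ^ d" for i by (metis Q abs_le_D1 of_nat_0_le_iff)
  have C: "C \<ge> 0" using order_trans[OF of_nat_0_le_iff q[of 0]] by simp
  have bound: "2 ^ n \<le> 2 * C * real n ^ (d + 2)" if n: "n \<ge> 2" for n
  proof -
    have "real (\<Sum>i<n. card (dyadic_primes i)) \<le> (\<Sum>i<n. C * real n ^ d)"
      unfolding of_nat_sum
    proof (rule sum_mono)
      fix i assume "i \<in> {..<n}"
      \<comment> \<open>Since \<open>1 + i \<le> n\<close>, one bound serves all blocks below
        \<open>n\<close>.\<close>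
      then have "(1 + real i) ^ d \<le> real n ^ d" by (intro power_mono) auto
      then have "C * (1 + real i) ^ d \<le> C * real n ^ d" using C by (rule mult_left_mono)
      then show "real (card (dyadic_primes i)) \<le> C * real n ^ d"
        using q[of i] le[of i] by linarith
    qed
    then have s: "real (\<Sum>i<n. card (dyadic_primes i)) \<le> real n * (C * real n ^ d)" by simp
    have "2 ^ n \<le> real (2 * n * (\<Sum>i<n. card (dyadic_primes i)))"
      using chebyshev_dyadic[OF n] by (metis of_nat_le_iff of_nat_numeral of_nat_power)
    also have "\<dots> \<le> 2 * real n * (real n * (C * real n ^ d))"
      using mult_left_mono[OF s, of "2 * real n"] by simp
    finally show ?thesis by (simp add: power_add power2_eq_square mult_ac)
  qed
  have "(\<lambda>n. 2 * C * real n ^ (d + 2) / 2 ^ n) \<longlonglongrightarrow> 0"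
    using tendsto_mult[OF tendsto_const power_over_two_power_tendsto_0[of "d + 2"], of "2 * C"] by simp
  then have "\<forall>\<^sub>F n in sequentially. 2 * C * real n ^ (d + 2) / 2 ^ n < 1"
    by (rule order_tendstoD) simp
  then have "\<forall>\<^sub>F n::nat in sequentially. False"
    using eventually_ge_at_top[of 2]
  proof eventually_elim
    case (elim n)
    then show ?case using bound[of n] by (simp add: field_simps)
  qed
  then show False by simp
qed

section \<open>Denominators of harmonic sums\<close>

text \<open>Among the summands only \<open>1 / p\<close> has \<open>p\<close> in its denominator, so
  clearing the other denominators leaves an integer identity modulo \<open>p\<close>. Here
  \<open>b\<close> is any denominator of the sum, reduced or not.\<close>

lemma prime_dvd_denominator:
  fixes p :: nat and b :: int
  assumes p: "p \<in> dyadic_primes n"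
    and eq: "(\<Sum>k\<in>{2 ^ n..<2 ^ Suc n}. 1 / rat_of_nat k) * of_int b = of_int a"
  shows "int p dvd b"
proof -
  let ?K = "{2 ^ n..<2 ^ Suc n} - {p}"
  \<comment> \<open>\<open>e / c\<close> is the sum of the terms other than \<open>1 / p\<close>,
    over their product as common denominator.\<close>
  define c where "c = (\<Prod>k\<in>?K. int k)"
  define e where "e = (\<Sum>k\<in>?K. \<Prod>j\<in>?K - {k}. int j)"
  have pr: "prime p" and pK: "p \<in> {2 ^ n..<2 ^ Suc n}" using p by (auto simp: dyadic_primes_def)
  have nz: "k \<noteq> 0" if "k \<in> ?K" for k
    using that by (metis DiffD1 atLeastLessThan_iff not_less0 power_not_zero le_zero_eq zero_neq_numeral)
  \<comment> \<open>As \<open>p\<close> is at least \<open>2 ^ n\<close>, its next multiple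
    \<open>2 * p\<close> lies beyond the range of summation.\<close>
  have "\<not> p dvd k" if k: "k \<in> ?K" for k
  proof
    assume "p dvd k"
    then obtain m where m: "k = p * m" by blast
    have "m \<noteq> 0" "m \<noteq> 1" using m k nz[OF k] by auto
    then have "m \<ge> 2" by simp
    then have "2 * p \<le> k" unfolding m by simp
    then show False using k pK by auto
  qed
  then have ndvd: "\<not> int p dvd c"
    unfolding c_def using pr by (subst prime_dvd_prod_iff) auto
  have "(\<Sum>k\<in>?K. 1 / rat_of_nat k) * of_int c = (\<Sum>k\<in>?K. 1 / rat_of_nat k * of_int c)"
    by (rule sum_distrib_right)
  also have "\<dots> = (\<Sum>k\<in>?K. of_int (\<Prod>j\<in>?K - {k}. int j))"
  proof (rule sum.cong)
    fix k assume k: "k \<in> ?K"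
    have "c = int k * (\<Prod>j\<in>?K - {k}. int j)" unfolding c_def using k by (intro prod.remove) auto
    then show "1 / rat_of_nat k * of_int c = of_int (\<Prod>j\<in>?K - {k}. int j)"
      using nz[OF k] by simp
  qed simp
  also have "\<dots> = of_int e" by (simp add: e_def)
  finally have rest: "(\<Sum>k\<in>?K. 1 / rat_of_nat k) * of_int c = of_int e" .
  have p0: "rat_of_nat p \<noteq> 0" using pr by auto
  have split: "(\<Sum>k\<in>{2 ^ n..<2 ^ Suc n}. 1 / rat_of_nat k) = 1 / rat_of_nat p + (\<Sum>k\<in>?K. 1 / rat_of_nat k)"
    using pK by (intro sum.remove) auto
  define s where "s = (\<Sum>k\<in>?K. 1 / rat_of_nat k)"
  \<comment> \<open>Multiplying the equation by \<open>p * c\<close> makes every term an integer and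
    isolates \<open>c * b\<close> as a multiple of \<open>p\<close>.\<close>
  have "of_int c * of_int b = rat_of_nat p * of_int c * (1 / rat_of_nat p * of_int b)"
    using p0 by simp
  also have "1 / rat_of_nat p * of_int b = of_int a - s * of_int b"
    using eq unfolding split s_def[symmetric] by (simp add: algebra_simps)
  also have "rat_of_nat p * of_int c * (of_int a - s * of_int b) =
      rat_of_nat p * (of_int c * of_int a - (s * of_int c) * of_int b)"
    by (simp add: algebra_simps)
  also have "s * of_int c = of_int e" unfolding s_def by (rule rest)
  finally have "rat_of_int (c * b) = of_int (int p * (c * a - e * b))" by simp
  then have "c * b = int p * (c * a - e * b)" unfolding of_int_eq_iff .
  then have "int p dvd c * b" by simp
  then show ?thesis using ndvd pr by (simp add: prime_dvd_mult_iff)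
qed

lemma prod_primes_dvd:
  assumes "finite A" "\<And>p. p \<in> A \<Longrightarrow> prime p" "\<And>p. p \<in> A \<Longrightarrow> p dvd (b :: nat)"
  shows "\<Prod>A dvd b"
  using assms
proof (induction A rule: finite_induct)
  case (insert p A)
  have "coprime p (\<Prod>A)"
    using insert by (intro prod_coprime_right) (metis insertCI primes_coprime)
  then show ?case using insert by (simp add: divides_mult)
qed simp

text \<open>All primes of the block divide \<open>b\<close>, hence so does their product, and each
  factor is at least 2.\<close>

lemma two_power_card_dyadic_primes_le:
  assumes "(\<Sum>k\<in>{2 ^ n..<2 ^ Suc n}. 1 / rat_of_nat k) * of_int b = of_int a" "b > 0"
  shows "2 ^ card (dyadic_primes n) \<le> b"
proof -
  have "\<Prod>(dyadic_primes n) dvd nat b"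
  proof (rule prod_primes_dvd)
    fix p assume "p \<in> dyadic_primes n"
    then have "int p dvd b" using prime_dvd_denominator assms by blast
    then show "p dvd nat b" by (metis assms(2) int_dvd_int_iff int_nat_eq less_le)
  qed (auto simp: dyadic_primes_def)
  then have "\<Prod>(dyadic_primes n) \<le> nat b" using assms(2) by (intro dvd_imp_le) auto
  moreover have "(\<Prod>p\<in>dyadic_primes n. 2) \<le> \<Prod>(dyadic_primes n)"
    by (intro prod_mono) (auto simp: dyadic_primes_def prime_ge_2_nat)
  then have "2 ^ card (dyadic_primes n) \<le> \<Prod>(dyadic_primes n)" by simp
  ultimately have "2 ^ card (dyadic_primes n) \<le> nat b" by (rule order_trans[rotated])
  then have "int (2 ^ card (dyadic_primes n)) \<le> int (nat b)" by (rule of_nat_mono)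
  then show ?thesis using assms(2) by simp
qed

section \<open>Length of machine outputs\<close>

lemma less_power_length_binary: "n < 2 ^ length (binary n)"
proof (induction n rule: binary.induct)
  case (1 n)
  show ?case
  proof (cases "n < 2")
    case True
    then show ?thesis by (subst binary.simps) auto
  next
    case False
    then have "n div 2 < 2 ^ length (binary (n div 2))" using 1 by blast
    then show ?thesis using False by (subst binary.simps) auto
  qed
qed

text \<open>The denominator is written out within the string, so it has at most \<open>k\<close>
  binary digits.\<close>

lemma encodes_rat_denominator:
  assumes "encodes_rat r s" "length s \<le> k"
  shows "\<exists>a b. 0 < b \<and> r = of_int a / of_int b \<and> b < 2 ^ k"
proof -
  obtain a b where ab: "0 < b" "r = of_int a / of_int b" "s = enc_int a @ [Slash] @ enc_int b"
    using assms unfolding encodes_rat_def by blast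
  have "length (binary (nat b)) \<le> k"
    using ab assms(2) by (simp add: enc_int_def enc_nat_def)
  then have "(2::nat) ^ length (binary (nat b)) \<le> 2 ^ k" by (intro power_increasing) auto
  then have "nat b < 2 ^ k" using less_power_length_binary[of "nat b"] by linarith
  then have "int (nat b) < int (2 ^ k)" by (simp only: of_nat_less_iff)
  then have "b < 2 ^ k" using ab(1) by simp
  then show ?thesis using ab by blast
qed

section \<open>Growth of the output tape during a computation\<close>

definition nonblank :: "tape \<Rightarrow> int set" where
  "nonblank tp = {i. fst tp i \<noteq> Blank}"

lemma length_contents_le_card_nonblank:
  assumes "finite (nonblank tp)"
  shows "length (contents tp) \<le> card (nonblank tp)"
proof -
  let ?n = "LEAST n. fst tp (int n) = Blank"
  have "int ` {..<?n} \<subseteq> nonblank tp"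
    using not_less_Least by (auto simp: nonblank_def)
  then have "card (int ` {..<?n}) \<le> card (nonblank tp)" by (rule card_mono[OF assms])
  then show ?thesis by (simp add: contents_def card_image)
qed

lemma nonblank_act: "nonblank (act a tp) \<subseteq> insert (snd tp) (nonblank tp)"
  by (auto simp: nonblank_def act_def)

text \<open>An invariant for \<open>t\<close> steps. The bound on tape 1 is the purpose; the
  conditions on state, tapes and symbols make \<open>wf_machine\<close> applicable to the next
  transition.\<close>

definition output_bounded :: "'m machine_scheme \<Rightarrow> nat \<Rightarrow> config \<Rightarrow> bool" where
  "output_bounded M t = (\<lambda>(q, ts).
     q \<in> states M \<and> length ts = tape_count M \<and> (\<forall>tp \<in> set ts. range (fst tp) \<subseteq> alphabet M) \<and>
     finite (nonblank (ts ! 1)) \<and> card (nonblank (ts ! 1)) \<le> t)"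

lemma range_tape_of: "range (fst (tape_of s)) \<subseteq> insert Blank (set s)"
  by (auto simp: tape_of_def)

lemma nonblank_tape_of_Nil: "nonblank (tape_of []) = {}"
  by (auto simp: nonblank_def tape_of_def)

lemma output_bounded_initial:
  assumes "wf_machine M" "set s \<subseteq> io_symbols"
  shows "output_bounded M 0 (initial M s)"
proof -
  have c: "2 \<le> tape_count M" "io_symbols \<subseteq> alphabet M" "Blank \<in> io_symbols"
    using assms by (auto simp: wf_machine_def io_symbols_def)
  have "range (fst tp) \<subseteq> alphabet M"
    if "tp \<in> set ((replicate (tape_count M) (tape_of []))[0 := tape_of s])" for tp
  proof -
    have "tp = tape_of s \<or> tp = tape_of []"
      using subsetD[OF set_update_subset_insert that] by auto
    moreover have "insert Blank (set s) \<subseteq> alphabet M" "insert Blank (set []) \<subseteq> alphabet M"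
      using c assms(2) by auto
    ultimately show ?thesis using range_tape_of order_trans by metis
  qed
  moreover have "(replicate (tape_count M) (tape_of []))[0 := tape_of s] ! 1 = tape_of []"
    using c by simp
  ultimately show ?thesis using assms(1)
    by (simp add: output_bounded_def initial_def wf_machine_def nonblank_tape_of_Nil del: One_nat_def)
qed

text \<open>Only the scanned cell of a tape is written, so a step adds at most one nonblank cell to
  the output tape.\<close>

lemma output_bounded_step:
  assumes wf: "wf_machine M" and b: "output_bounded M t (q, ts)"
  shows "output_bounded M (Suc t) (step M (q, ts))"
proof (cases "q = halt M")
  case True
  then show ?thesis using b by (auto simp: step_def output_bounded_def)
next
  case False
  obtain q' as where tr: "trans M q (map read ts) = (q', as)" by fastforce
  have len: "length ts = tape_count M" and q: "q \<in> states M"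
    and alph: "\<And>tp. tp \<in> set ts \<Longrightarrow> range (fst tp) \<subseteq> alphabet M"
    and fin: "finite (nonblank (ts ! 1))" and card: "card (nonblank (ts ! 1)) \<le> t"
    using b by (auto simp: output_bounded_def)
  have "read tp \<in> alphabet M" if "tp \<in> set ts" for tp
    using alph[OF that] by (auto simp: read_def)
  then have scanned: "length (map read ts) = tape_count M \<and> set (map read ts) \<subseteq> alphabet M"
    using len by auto
  have next_ok: "\<forall>s. length s = tape_count M \<and> set s \<subseteq> alphabet M \<longrightarrow>
      (case trans M q s of (q', as) \<Rightarrow>
        q' \<in> states M \<and> length as = tape_count M \<and> fst ` set as \<subseteq> alphabet M)"
  proof -
    have "\<forall>q \<in> states M - {halt M}. \<forall>s. length s = tape_count M \<and> set s \<subseteq> alphabet M \<longrightarrow>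
      (case trans M q s of (q', as) \<Rightarrow>
        q' \<in> states M \<and> length as = tape_count M \<and> fst ` set as \<subseteq> alphabet M)"
      using wf unfolding wf_machine_def by (elim conjE)
    then show ?thesis using q False by (elim bspec) simp
  qed
  have "case trans M q (map read ts) of (q', as) \<Rightarrow>
      q' \<in> states M \<and> length as = tape_count M \<and> fst ` set as \<subseteq> alphabet M"
    by (rule next_ok[THEN spec, THEN mp, OF scanned])
  then have q': "q' \<in> states M" "length as = tape_count M" "fst ` set as \<subseteq> alphabet M"
    unfolding tr case_prod_conv by iprover+
  have "range (fst tp) \<subseteq> alphabet M" if "tp \<in> set (map2 act as ts)" for tp
  proof -
    from that obtain z where z: "z \<in> set (zip as ts)" "tp = act (fst z) (snd z)" by auto
    then obtain a tp' where "a \<in> set as" "tp' \<in> set ts" "tp = act a tp'"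
      by (metis prod.collapse set_zip_leftD set_zip_rightD)
    then show ?thesis using alph[of tp'] q'(3) by (auto simp: act_def image_subset_iff)
  qed
  then have "\<forall>tp \<in> set (map2 act as ts). range (fst tp) \<subseteq> alphabet M" by (rule ballI)
  moreover have "1 < tape_count M" using wf by (simp add: wf_machine_def)
  \<comment> \<open>\<open>map2\<close> stops at the shorter list; equal lengths ensure that tape 1
    survives at its index.\<close>
  then have nth: "map2 act as ts ! 1 = act (as ! 1) (ts ! 1)" using len q' by simp
  have sub: "nonblank (map2 act as ts ! 1) \<subseteq> insert (snd (ts ! 1)) (nonblank (ts ! 1))"
    unfolding nth by (rule nonblank_act)
  then have "finite (nonblank (map2 act as ts ! 1))"
    using fin finite_subset by blast
  moreover have "card (nonblank (map2 act as ts ! 1)) \<le> Suc t"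
    using card_mono[OF _ sub] fin card card_insert_le_m1[of "Suc t" "nonblank (ts ! 1)" "snd (ts ! 1)"]
    by simp
  moreover have "step M (q, ts) = (q', map2 act as ts)"
    using False tr by (simp add: step_def)
  moreover have "length (map2 act as ts) = tape_count M" using q'(2) len by simp
  ultimately show ?thesis
    using q'(1) unfolding output_bounded_def by (simp only: case_prod_conv simp_thms)
qed

text \<open>A query changes tapes 2 and 3 only. The output tape stays as it is however long the
  answer, so the bound holds for every oracle \<open>g\<close>.\<close>

lemma output_bounded_oracle_step:
  assumes wf: "wf_oracle_machine M" and b: "output_bounded M t (q, ts)"
  shows "output_bounded M (Suc t) (oracle_step g M (q, ts))"
proof (cases "q = query_state M")
  case False
  then show ?thesis
    using output_bounded_step[of M t q ts] assms by (simp add: oracle_step_def wf_oracle_machine_def)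
next
  case True
  let ?n = "g (map the_bit (takeWhile is_Bit (contents (ts ! 2))))"
  have c: "4 \<le> tape_count M" "io_symbols \<subseteq> alphabet M" "answer_state M \<in> states M"
    using wf by (auto simp: wf_oracle_machine_def wf_machine_def)
  have io: "set (enc_nat n) \<subseteq> io_symbols" "Blank \<in> io_symbols" for n
    by (auto simp: enc_nat_def io_symbols_def)
  have "range (fst tp) \<subseteq> alphabet M"
    if "tp \<in> set (ts[2 := tape_of [], 3 := tape_of (enc_nat ?n)])" for tp
  proof -
    have "tp \<in> set ts \<or> tp = tape_of [] \<or> tp = tape_of (enc_nat ?n)"
      using that by (meson insertE set_update_subset_insert subsetD)
    moreover have "insert Blank (set (enc_nat ?n)) \<subseteq> alphabet M" "insert Blank (set []) \<subseteq> alphabet M"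
      using c io by auto
    then have "range (fst (tape_of (enc_nat ?n))) \<subseteq> alphabet M" "range (fst (tape_of [])) \<subseteq> alphabet M"
      by (iprover intro: order_trans[OF range_tape_of])+
    moreover have "\<forall>tp \<in> set ts. range (fst tp) \<subseteq> alphabet M"
      using b by (simp add: output_bounded_def)
    ultimately show ?thesis by blast
  qed
  then have "\<forall>tp \<in> set (ts[2 := tape_of [], 3 := tape_of (enc_nat ?n)]). range (fst tp) \<subseteq> alphabet M"
    by blast
  moreover have "oracle_step g M (q, ts) = (answer_state M, ts[2 := tape_of [], 3 := tape_of (enc_nat ?n)])"
    using True by (simp only: oracle_step_def case_prod_conv simp_thms if_True)
  moreover have "ts[2 := tape_of [], 3 := tape_of (enc_nat ?n)] ! 1 = ts ! 1" by simp
  moreover have "length ts = tape_count M" "finite (nonblank (ts ! 1))" "card (nonblank (ts ! 1)) \<le> Suc t"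
    using b unfolding output_bounded_def case_prod_conv by linarith+
  ultimately show ?thesis
    using c(3) unfolding output_bounded_def by (simp only: case_prod_conv length_list_update simp_thms)
qed

text \<open>The step function \<open>S\<close> is arbitrary in order to cover machines with and
  without oracle.\<close>

lemma output_bounded_funpow:
  assumes "\<And>t q ts. output_bounded M t (q, ts) \<Longrightarrow> output_bounded M (Suc t) (S (q, ts))"
    and "output_bounded M 0 c"
  shows "output_bounded M t ((S ^^ t) c)"
proof (induction t)
  case (Suc t)
  obtain q ts where "(S ^^ t) c = (q, ts)" by fastforce
  then show ?case using assms(1) Suc by simp
qed (use assms in simp)

lemma output_bounded_length_contents:
  "output_bounded M t (q, ts) \<Longrightarrow> length (contents (ts ! 1)) \<le> t"
  using length_contents_le_card_nonblank[of "ts ! 1"] by (auto simp: output_bounded_def)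

section \<open>Denominators of polynomial-time outputs\<close>

lemma set_enc_string: "set (enc_string x) \<subseteq> io_symbols"
  by (auto simp: enc_string_def io_symbols_def)

text \<open>The property that separates the classes: with polynomial \<open>p\<close> it holds for
  all rational functions in polynomial time, even with an oracle, but fails for
  \<open>harmonic_block\<close>.\<close>

definition denominator_bound :: "(nat \<Rightarrow> nat) \<Rightarrow> (bool list \<Rightarrow> rat) \<Rightarrow> bool" where
  "denominator_bound p f \<longleftrightarrow>
     (\<forall>x. \<exists>a b. 0 < b \<and> f x = of_int a / of_int b \<and> b < 2 ^ p (length x))"

lemma polytime_rat_denominator:
  assumes "polytime enc_string encodes_rat f"
  shows "\<exists>p. polynomial_fun p \<and> denominator_bound p f"
proof -
  obtain M :: machine and p where M: "wf_machine M" "polynomial_fun p"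
    and run: "\<And>x. case (step M ^^ p (length (enc_string x))) (initial M (enc_string x)) of
      (q, ts) \<Rightarrow> q = halt M \<and> encodes_rat (f x) (contents (ts ! 1))"
    using assms unfolding polytime_def by blast
  have "denominator_bound p f"
    unfolding denominator_bound_def
  proof
    fix x
    obtain q ts where c: "(step M ^^ p (length x)) (initial M (enc_string x)) = (q, ts)" by fastforce
    have enc: "encodes_rat (f x) (contents (ts ! 1))"
      using run[of x] c by (simp add: enc_string_def)
    have "output_bounded M (p (length x)) (q, ts)"
      unfolding c[symmetric]
      by (rule output_bounded_funpow[where S = "step M", OF output_bounded_step[OF M(1)]
            output_bounded_initial[OF M(1) set_enc_string]])
    then show "\<exists>a b. 0 < b \<and> f x = of_int a / of_int b \<and> b < 2 ^ p (length x)"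
      by (intro encodes_rat_denominator[OF enc] output_bounded_length_contents)
  qed
  then show ?thesis using M(2) by blast
qed

lemma oracle_polytime_rat_denominator:
  assumes "oracle_polytime g enc_string encodes_rat f"
  shows "\<exists>p. polynomial_fun p \<and> denominator_bound p f"
proof -
  obtain M p where M: "wf_oracle_machine M" "polynomial_fun p"
    and run: "\<And>x. case (oracle_step g M ^^ p (length (enc_string x))) (initial M (enc_string x)) of
      (q, ts) \<Rightarrow> q = halt M \<and> encodes_rat (f x) (contents (ts ! 1))"
    using assms unfolding oracle_polytime_def by blast
  have wf: "wf_machine M" using M(1) by (simp add: wf_oracle_machine_def)
  have "denominator_bound p f"
    unfolding denominator_bound_def
  proof
    fix x
    obtain q ts where c: "(oracle_step g M ^^ p (length x)) (initial M (enc_string x)) = (q, ts)" by fastforce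
    have enc: "encodes_rat (f x) (contents (ts ! 1))"
      using run[of x] c by (simp add: enc_string_def)
    have "output_bounded M (p (length x)) (q, ts)"
      unfolding c[symmetric]
      by (rule output_bounded_funpow[where S = "oracle_step g M", OF output_bounded_oracle_step[OF M(1)]
            output_bounded_initial[OF wf set_enc_string]])
    then show "\<exists>a b. 0 < b \<and> f x = of_int a / of_int b \<and> b < 2 ^ p (length x)"
      by (intro encodes_rat_denominator[OF enc] output_bounded_length_contents)
  qed
  then show ?thesis using M(2) by blast
qed

section \<open>A machine computing reciprocals\<close>

text \<open>The initial value 1 acts as a leading bit 1 in front of \<open>u\<close>, so leading
  zeros of \<open>u\<close> count and the value is never 0.\<close>

definition bits_value :: "bool list \<Rightarrow> nat" where
  "bits_value u = foldl (\<lambda>n b. 2 * n + of_bool b) 1 u"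

lemma bits_value_simps [simp]:
  "bits_value [] = 1" "bits_value (u @ [b]) = 2 * bits_value u + of_bool b"
  by (simp_all add: bits_value_def)

lemma bits_value_pos: "bits_value u > 0"
  by (induction u rule: rev_induct) auto

text \<open>This lets a machine write the denominator by copying \<open>u\<close> behind a 1,
  without arithmetic.\<close>

lemma binary_bits_value: "binary (bits_value u) = True # u"
proof (induction u rule: rev_induct)
  case (snoc b u)
  then show ?case using bits_value_pos[of u] by (subst binary.simps) auto
qed (subst binary.simps, simp)

lemma bits_value_bounds: "2 ^ length u \<le> bits_value u \<and> bits_value u < 2 ^ Suc (length u)"
  by (induction u rule: rev_induct) auto

text \<open>Injective because \<open>binary\<close> recovers \<open>u\<close>; onto because both
  sets have \<open>2 ^ n\<close> elements.\<close>

lemma bij_betw_bits_value: "bij_betw bits_value {u. length u = n} {2 ^ n..<2 ^ Suc n}"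
proof -
  have inj: "inj_on bits_value {u. length u = n}"
    by (metis binary_bits_value inj_onI list.inject)
  have "bits_value ` {u. length u = n} = {2 ^ n..<2 ^ Suc n}"
  proof (rule card_subset_eq)
    show "bits_value ` {u. length u = n} \<subseteq> {2 ^ n..<2 ^ Suc n}"
      using bits_value_bounds by auto
    show "card (bits_value ` {u. length u = n}) = card {2 ^ n..<(2::nat) ^ Suc n}"
      using card_lists_length_eq[of "UNIV :: bool set" n] by (simp add: card_image[OF inj])
  qed simp
  then show ?thesis using inj by (simp add: bij_betw_def)
qed

text \<open>A difference of two harmonic numbers, depending on the length of \<open>x\<close>
  only.\<close>

definition harmonic_block :: "bool list \<Rightarrow> rat" where
  "harmonic_block x = (\<Sum>k\<in>{2 ^ length x..<2 ^ Suc (length x)}. 1 / rat_of_nat k)"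

lemma harmonic_block_bits:
  "harmonic_block x = (\<Sum>u | length u = length x. 1 / rat_of_nat (bits_value u))"
  unfolding harmonic_block_def by (rule sum.reindex_bij_betw[OF bij_betw_bits_value, symmetric])

lemma encodes_rat_inverse_bits_value:
  "encodes_rat (1 / rat_of_nat (bits_value u)) ([Bit True, Slash, Bit True] @ map Bit u)"
  unfolding encodes_rat_def
proof (intro exI conjI)
  show "0 < int (bits_value u)" using bits_value_pos[of u] by simp
  show "1 / rat_of_nat (bits_value u) = of_int 1 / of_int (int (bits_value u))" by simp
  show "[Bit True, Slash, Bit True] @ map Bit u = enc_int 1 @ [Slash] @ enc_int (int (bits_value u))"
    using binary_bits_value[of "[]"] by (simp add: enc_int_def enc_nat_def binary_bits_value)
qed

text \<open>A zipper: \<open>l\<close> lies to the left of the head, and \<open>r\<close> starts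
  under it. Moves to the right become operations on lists.\<close>

definition tape_at :: "symbol list \<Rightarrow> symbol list \<Rightarrow> tape" where
  "tape_at l r = (fst (tape_of (l @ r)), int (length l))"

lemma tape_of_eq_tape_at: "tape_of s = tape_at [] s"
  by (simp add: tape_at_def tape_of_def)

lemma read_tape_at [simp]: "read (tape_at l []) = Blank" "read (tape_at l (c # r)) = c"
  by (auto simp: tape_at_def tape_of_def read_def)

lemma act_tape_at [simp]:
  "act (c, MRight) (tape_at l []) = tape_at (l @ [c]) []"
  "act (c, MRight) (tape_at l (d # r)) = tape_at (l @ [c]) r"
  by (auto simp: tape_at_def tape_of_def act_def nth_append nth_Cons' fun_eq_iff)

lemma act_read_MStay [simp]: "act (read tp, MStay) tp = tp"
  by (simp add: act_def read_def)

lemma act_Blank_MStay [simp]: "act (Blank, MStay) (tape_at l []) = tape_at l []"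
  using act_read_MStay[of "tape_at l []"] by simp

lemma contents_tape_at: "Blank \<notin> set l \<Longrightarrow> contents (tape_at l []) = l"
proof -
  assume b: "Blank \<notin> set l"
  have "(LEAST n. fst (tape_at l []) (int n) = Blank) = length l"
  proof (rule Least_equality)
    show "length l \<le> n" if "fst (tape_at l []) (int n) = Blank" for n
    proof (rule ccontr)
      assume "\<not> length l \<le> n"
      then have "n < length l" by simp
      moreover from this have "l ! n = Blank" using that by (simp add: tape_at_def tape_of_def)
      ultimately show False using b nth_mem by metis
    qed
  qed (simp add: tape_at_def tape_of_def)
  then show ?thesis by (auto simp: contents_def tape_at_def tape_of_def intro: nth_equalityI)
qed

text \<open>Started on \<open>x Sep u\<close>, skips to the separator and writes \<open>1/1u\<close>.\<close>

definition reciprocal_trans :: "nat \<Rightarrow> symbol list \<Rightarrow> nat \<times> (symbol \<times> move) list" where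
  "reciprocal_trans q s =
     (if q = 0 then
        if s ! 0 = Sep then (1, [(Sep, MRight), (Bit True, MRight)])
        else (0, [(s ! 0, MRight), (Blank, MStay)])
      else if q = 1 then (2, [(s ! 0, MStay), (Slash, MRight)])
      else if q = 2 then (3, [(s ! 0, MStay), (Bit True, MRight)])
      else if s ! 0 = Blank then (4, [(Blank, MStay), (Blank, MStay)])
      else (3, [(s ! 0, MRight), (s ! 0, MRight)]))"

text \<open>State 0 skips \<open>x\<close> and writes the numerator at the separator, states 1 and 2
  write the slash and the leading bit, state 3 copies \<open>u\<close>, and state 4 halts.\<close>

definition reciprocal_machine :: machine where
  "reciprocal_machine =
     \<lparr>tape_count = 2, states = {0, 1, 2, 3, 4}, alphabet = io_symbols, start = 0, halt = 4,
      trans = reciprocal_trans\<rparr>"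

lemma wf_reciprocal_machine: "wf_machine reciprocal_machine"
proof -
  have "s ! 0 \<in> io_symbols" if "length s = 2" "set s \<subseteq> io_symbols" for s
    using that nth_mem[of 0 s] by auto
  moreover have "{Blank, Bit True, Slash, Sep} \<subseteq> io_symbols" by (simp add: io_symbols_def)
  ultimately show ?thesis
    unfolding wf_machine_def reciprocal_machine_def
    by (auto simp: reciprocal_trans_def) (auto simp: io_symbols_def)
qed

section \<open>Runs of the reciprocal machine\<close>

abbreviation "reciprocal_step \<equiv> step reciprocal_machine"

lemma reciprocal_step_simps:
  "c \<noteq> Sep \<Longrightarrow> reciprocal_step (0, [tape_at l (c # r), tape_at [] []]) =
     (0, [tape_at (l @ [c]) r, tape_at [] []])"
  "reciprocal_step (0, [tape_at l (Sep # r), tape_at k []]) =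
     (1, [tape_at (l @ [Sep]) r, tape_at (k @ [Bit True]) []])"
  "reciprocal_step (1, [tp, tape_at k []]) = (2, [tp, tape_at (k @ [Slash]) []])"
  "reciprocal_step (2, [tp, tape_at k []]) = (3, [tp, tape_at (k @ [Bit True]) []])"
  "c \<noteq> Blank \<Longrightarrow> reciprocal_step (3, [tape_at l (c # r), tape_at k []]) =
     (3, [tape_at (l @ [c]) r, tape_at (k @ [c]) []])"
  "reciprocal_step (3, [tape_at l [], tape_at k []]) = (4, [tape_at l [], tape_at k []])"
  by (simp_all add: step_def reciprocal_machine_def reciprocal_trans_def)

lemma reciprocal_skip:
  "(reciprocal_step ^^ length x) (0, [tape_at l (map Bit x @ r), tape_at [] []]) =
     (0, [tape_at (l @ map Bit x) r, tape_at [] []])"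
  by (induction x arbitrary: l) (simp_all add: funpow_Suc_right reciprocal_step_simps del: funpow.simps(2))

lemma reciprocal_copy:
  "(reciprocal_step ^^ length u) (3, [tape_at l (map Bit u), tape_at k []]) =
     (3, [tape_at (l @ map Bit u) [], tape_at (k @ map Bit u) []])"
  by (induction u arbitrary: l k) (simp_all add: funpow_Suc_right reciprocal_step_simps del: funpow.simps(2))

lemma reciprocal_run:
  "\<exists>tp. (reciprocal_step ^^ (length (enc_pair (x, u)) + 3)) (initial reciprocal_machine (enc_pair (x, u))) =
     (4, [tp, tape_at ([Bit True, Slash, Bit True] @ map Bit u) []])"
proof -
  have init: "initial reciprocal_machine (enc_pair (x, u)) =
      (0, [tape_at [] (map Bit x @ Sep # map Bit u), tape_at [] []])"
    by (simp add: initial_def reciprocal_machine_def enc_pair_def enc_string_def tape_of_eq_tape_at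
        numeral_2_eq_2)
  \<comment> \<open>From right to left, in order of execution: skip \<open>x\<close>, pass the
    separator, write the slash, write the leading 1, copy \<open>u\<close>, halt on the
    blank.\<close>
  have len: "length (enc_pair (x, u)) + 3 = 1 + (length u + (1 + (1 + (1 + length x))))"
    by (simp add: enc_pair_def enc_string_def)
  show ?thesis
    unfolding len funpow_add o_apply init reciprocal_skip
    by (simp add: reciprocal_step_simps[unfolded One_nat_def] reciprocal_copy)
qed

lemma polytime_reciprocal:
  "polytime enc_pair encodes_rat (\<lambda>(x, u). 1 / rat_of_nat (bits_value u))"
  unfolding polytime_def
proof (intro exI conjI allI)
  show "wf_machine reciprocal_machine" by (rule wf_reciprocal_machine)
  show "polynomial_fun (\<lambda>n. n + 3)"
    unfolding polynomial_fun_def by (rule exI[of _ "[:3, 1:]"]) simp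
  fix a :: "bool list \<times> bool list"
  obtain x u where a: "a = (x, u)" by fastforce
  obtain tp where "(reciprocal_step ^^ (length (enc_pair a) + 3)) (initial reciprocal_machine (enc_pair a)) =
     (4, [tp, tape_at ([Bit True, Slash, Bit True] @ map Bit u) []])"
    using reciprocal_run unfolding a by blast
  moreover have "contents (tape_at ([Bit True, Slash, Bit True] @ map Bit u) []) = [Bit True, Slash, Bit True] @ map Bit u"
    by (rule contents_tape_at) auto
  ultimately show "case (reciprocal_step ^^ (length (enc_pair a) + 3)) (initial reciprocal_machine (enc_pair a)) of
      (q, ts) \<Rightarrow> q = halt reciprocal_machine \<and>
        encodes_rat (case a of (x, u) \<Rightarrow> 1 / rat_of_nat (bits_value u)) (contents (ts ! 1))"
    using encodes_rat_inverse_bits_value[of u] by (simp add: a reciprocal_machine_def)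
qed

lemma harmonic_block_in_sharpP_Q_pt: "harmonic_block \<in> sharpP_Q_pt"
proof -
  have "polynomial_fun (\<lambda>n. n)"
    unfolding polynomial_fun_def by (rule exI[of _ "[:0, 1:]"]) simp
  then show ?thesis
    unfolding sharpP_Q_pt_def using polytime_reciprocal harmonic_block_bits by fastforce
qed

section \<open>The separation\<close>

text \<open>At a length \<open>n\<close> whose block has more than \<open>q n\<close> primes, every
  positive denominator is at least 2 to the number of these primes, hence above
  \<open>2 ^ q n\<close>.\<close>

lemma harmonic_block_no_polynomial_denominator:
  assumes "polynomial_fun q"
  shows "\<not> denominator_bound q harmonic_block"
proof
  assume bound: "denominator_bound q harmonic_block"
  obtain n where n: "q n < card (dyadic_primes n)"
    using dyadic_primes_superpolynomial[OF assms(1)] by blast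
  obtain a b where ab: "0 < b" "harmonic_block (replicate n False) = of_int a / of_int b" "b < 2 ^ q n"
    using bound[unfolded denominator_bound_def, THEN spec, of "replicate n False"]
    unfolding length_replicate by blast
  have "harmonic_block (replicate n False) * of_int b = of_int a"
    using ab by simp
  then have "2 ^ card (dyadic_primes n) \<le> b"
    using ab(1) by (intro two_power_card_dyadic_primes_le) (simp_all add: harmonic_block_def)
  then have "(2::int) ^ card (dyadic_primes n) \<le> 2 ^ q n" using ab(3) by linarith
  then show False using n by simp
qed

theorem theorem6:
  "\<not> sharpP_equivalent ((\<lambda>f x. real_of_rat (f x)) ` sharpP_Q_pt) \<and>
   \<not> sharpP_Q_pt \<subseteq> FP_sharpP"
proof
  show "\<not> sharpP_Q_pt \<subseteq> FP_sharpP"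
  proof
    assume "sharpP_Q_pt \<subseteq> FP_sharpP"
    then have "harmonic_block \<in> FP_sharpP" using harmonic_block_in_sharpP_Q_pt by blast
    then obtain g where "oracle_polytime g enc_string encodes_rat harmonic_block"
      unfolding FP_sharpP_def by blast
    then show False
      using oracle_polytime_rat_denominator harmonic_block_no_polynomial_denominator by blast
  qed
next
  show "\<not> sharpP_equivalent ((\<lambda>f x. real_of_rat (f x)) ` sharpP_Q_pt)"
  proof
    assume "sharpP_equivalent ((\<lambda>f x. real_of_rat (f x)) ` sharpP_Q_pt)"
    \<comment> \<open>Already the reduction from the rational class to \<open>sharpP\<close> is
      impossible.\<close>
    then obtain g where "affinely_reduces (\<lambda>x. real_of_rat (harmonic_block x)) (\<lambda>x. of_nat (g x))"
      using harmonic_block_in_sharpP_Q_pt unfolding sharpP_equivalent_def by blast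
    then obtain h1 h2 h3 where h1: "polytime enc_string encodes_rat h1"
      and h3: "polytime enc_string encodes_rat h3"
      and eq: "\<And>x. real_of_rat (harmonic_block x) = of_rat (h1 x) * of_nat (g (h2 x)) + of_rat (h3 x)"
      unfolding affinely_reduces_def by blast
    obtain p1 where p1: "polynomial_fun p1" "denominator_bound p1 h1"
      using polytime_rat_denominator[OF h1] by blast
    obtain p3 where p3: "polynomial_fun p3" "denominator_bound p3 h3"
      using polytime_rat_denominator[OF h3] by blast
    \<comment> \<open>The values of \<open>g\<close> are integers and contribute nothing to the
      denominator, whatever their size and the query \<open>h2 x\<close>. The product of the
      denominators of \<open>h1 x\<close> and \<open>h3 x\<close> serves, and the exponents of their
      bounds add.\<close>
    have "denominator_bound (\<lambda>n. p1 n + p3 n) harmonic_block"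
      unfolding denominator_bound_def
    proof
      fix x
      obtain a1 b1 where 1: "0 < b1" "h1 x = of_int a1 / of_int b1" "b1 < 2 ^ p1 (length x)"
        using p1(2) unfolding denominator_bound_def by blast
      obtain a3 b3 where 3: "0 < b3" "h3 x = of_int a3 / of_int b3" "b3 < 2 ^ p3 (length x)"
        using p3(2) unfolding denominator_bound_def by blast
      have "real_of_rat (harmonic_block x) = of_rat (h1 x * of_nat (g (h2 x)) + h3 x)"
        using eq[of x] by (simp add: of_rat_add of_rat_mult)
      then have "harmonic_block x = h1 x * of_nat (g (h2 x)) + h3 x" by simp
      also have "\<dots> = of_int (a1 * int (g (h2 x)) * b3 + a3 * b1) / of_int (b1 * b3)"
        using 1 3 by (simp add: field_simps)
      finally have "harmonic_block x = of_int (a1 * int (g (h2 x)) * b3 + a3 * b1) / of_int (b1 * b3)" .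
      moreover have "b1 * b3 < 2 ^ (p1 (length x) + p3 (length x))"
        unfolding power_add using 1 3 by (intro mult_strict_mono) auto
      moreover have "0 < b1 * b3" using 1 3 by simp
      ultimately show "\<exists>a b. 0 < b \<and> harmonic_block x = of_int a / of_int b \<and>
          b < 2 ^ (p1 (length x) + p3 (length x))" by blast
    qed
    then show False
      using harmonic_block_no_polynomial_denominator polynomial_fun_add[OF p1(1) p3(1)] by blast
  qed
qed

end
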